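(* Let $m\geq 3$ be an integer, let $G$ be a bicyclic graph on $2m$ vertices with matching number $m$ (i.e. $G$ has a perfect matching), and let $D$ be any orientation of $G$. Then $$M_1(D)\leq \frac{1}{2}(m^2+9m+2),$$ with equality if and only if $D$ is isomorphic to $B^{(1)}_{2m,m}$ or to $B^{(2)}_{2m,m}$.
   Context: All graphs are finite and simple. A bicyclic graph is a connected graph with $|E|=|V|+1$. The matching number of a graph is the maximum number of pairwise disjoint edges. An orientation $D$ of a graph $G$ is obtained by replacing each edge $uv$ by exactly one of the arcs $uv$ or $vu$. For a vertex $u$ of $D$, $d^+_u$ and $d^-_u$ denote its out-degree and in-degree. The first Zagreb index of a digraph $D=(V,A)$ is $M_1(D)=\frac{1}{2}\sum_{uv\in A}(d^+_u+d^-_v)$. $B_{2m,m}$ is the bicyclic graph on $2m$ vertices obtained from two triangles sharing exactly one common vertex $c$ by attaching one pendent edge and $m-3$ paths of length two at $c$. The orientation $B^{(1)}_{2m,m}$: every edge incident with $c$ is oriented away from $c$; for each attached path $c\,a\,b$ the edge $ab$ is oriented from $b$ to $a$; in each triangle $c\,x\,y$ the edge $xy$ is oriented in either direction (both choices give isomorphic digraphs). $B^{(2)}_{2m,m}$ is obtained from $B^{(1)}_{2m,m}$ by reversing every arc. *)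

theory Defs
  imports "Graph_Theory.Graph_Theory"
begin

text \<open>A finite simple graph is a \<^const>\<open>pair_graph\<close>: every undirected edge is represented by
  both of its arcs, so edges are counted through their two-element sets of ends.\<close>

definition uedges :: "'a pair_pre_digraph \<Rightarrow> 'a set set" where
  "uedges G = (\<lambda>(u, v). {u, v}) ` parcs G"

definition bicyclic :: "'a pair_pre_digraph \<Rightarrow> bool" where
  "bicyclic G \<longleftrightarrow>
    pair_graph G \<and> connected (with_proj G) \<and> card (uedges G) = card (pverts G) + 1"

definition matching :: "'a pair_pre_digraph \<Rightarrow> 'a set set \<Rightarrow> bool" where
  "matching G M \<longleftrightarrow> M \<subseteq> uedges G \<and> pairwise disjnt M"

definition matching_number :: "'a pair_pre_digraph \<Rightarrow> nat" where
  "matching_number G = Max (card ` {M. matching G M})"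

definition orientation_of :: "'a pair_pre_digraph \<Rightarrow> 'a pair_pre_digraph \<Rightarrow> bool" where
  "orientation_of D G \<longleftrightarrow>
    pverts D = pverts G \<and> parcs D \<subseteq> parcs G \<and>
    (\<forall>(u, v) \<in> parcs G. ((u, v) \<in> parcs D) \<noteq> ((v, u) \<in> parcs D))"

definition first_zagreb :: "'a pair_pre_digraph \<Rightarrow> real" where
  "first_zagreb D = 1 / 2 *
    (\<Sum>(u, v) \<in> parcs D. real (out_degree (with_proj D) u) + real (in_degree (with_proj D) v))"

text \<open>Vertex labels: \<open>0\<close> is the common vertex \<open>c\<close>, \<open>1\<close> the end of the pendent edge,
  \<open>0, 2, 3\<close> and \<open>0, 4, 5\<close> are the two triangles, and \<open>0, 2 * i, 2 * i + 1\<close> with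
  \<open>3 \<le> i < m\<close> are the paths of length two. In the triangles the arcs \<open>(2, 3)\<close> and \<open>(4, 5)\<close>
  are chosen; lemma \<open>B1_triangle_choice\<close> below shows that the choice is immaterial.\<close>

definition B1 :: "nat \<Rightarrow> nat pair_pre_digraph" where
  "B1 m = \<lparr> pverts = {0..<2 * m},
     parcs = {(0, 1)} \<union> {(0, 2), (0, 3), (2, 3)} \<union> {(0, 4), (0, 5), (4, 5)}
       \<union> (\<Union>i \<in> {3..<m}. {(0, 2 * i), (2 * i + 1, 2 * i)}) \<rparr>"

definition B2 :: "nat \<Rightarrow> nat pair_pre_digraph" where
  "B2 m = \<lparr> pverts = pverts (B1 m), parcs = (parcs (B1 m))\<inverse> \<rparr>"

lemma B1_triangle_choice:
  assumes "m \<ge> 3" "e \<in> {(2, 3), (3, 2)}" "e' \<in> {(4, 5), (5, 4)}"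
  shows "digraph_iso (with_proj (B1 m))
    (with_proj \<lparr> pverts = pverts (B1 m), parcs = parcs (B1 m) - {(2, 3), (4, 5)} \<union> {e, e'} \<rparr>)"
proof -
  define f :: "nat \<Rightarrow> nat" where "f = (\<lambda>x.
    if x = 2 then fst e else if x = 3 then snd e else
    if x = 4 then fst e' else if x = 5 then snd e' else x)"
  define h where "h = \<lparr> iso_verts = f, iso_arcs = map_prod f f, iso_head = snd, iso_tail = fst \<rparr>"
  have ff: "f (f x) = x" for x using assms(2,3) by (auto simp: f_def)
  have inj: "inj f" by (metis ff injI)
  have V: "pverts (B1 m) = {0..<2 * m}" by (simp add: B1_def)
  have fV: "f ` {0..<2 * m} = {0..<2 * m}"
  proof -
    have sub: "f ` {0..<2 * m} \<subseteq> {0..<2 * m}" using assms by (auto simp: f_def)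
    then have "f ` f ` {0..<2 * m} \<subseteq> f ` {0..<2 * m}" by (rule image_mono)
    with sub show ?thesis by (simp add: image_image ff)
  qed
  define R where "R = (\<Union>i \<in> {3..<m}. {(0::nat, 2 * i), (2 * i + 1, 2 * i)})"
  have fR: "map_prod f f ` R = R"
  proof -
    have "map_prod f f p = p" if "p \<in> R" for p
      using that by (auto simp: R_def f_def; presburger)
    then show ?thesis by force
  qed
  have RN: "(2, 3) \<notin> R" "(4, 5) \<notin> R" by (auto simp: R_def; presburger)+
  have A: "parcs (B1 m) = {(0, 1)} \<union> {(0, 2), (0, 3), (2, 3)} \<union> {(0, 4), (0, 5), (4, 5)} \<union> R"
    by (simp add: B1_def R_def)
  have arcs: "map_prod f f ` parcs (B1 m) = parcs (B1 m) - {(2, 3), (4, 5)} \<union> {e, e'}"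
  proof -
    have "map_prod f f ` parcs (B1 m) =
        {(0, 1)} \<union> {(0, fst e), (0, snd e), e} \<union> {(0, fst e'), (0, snd e'), e'} \<union> R"
      unfolding A image_Un fR using assms(2,3) by (simp add: f_def)
    also have "\<dots> = {(0, 1), (0, 2), (0, 3), (0, 4), (0, 5)} \<union> R \<union> {e, e'}"
    proof -
      have "{(0, fst e), (0, snd e), e} = {(0, 2), (0, 3), e}"
        and "{(0, fst e'), (0, snd e'), e'} = {(0, 4), (0, 5), e'}"
        using assms(2,3) by (auto simp only: fst_conv snd_conv insert_iff empty_iff)
      then show ?thesis by (simp only:) blast
    qed
    also have "{(0, 1), (0, 2), (0, 3), (0, 4), (0, 5)} \<union> R = parcs (B1 m) - {(2, 3), (4, 5)}"
    proof -
      have "R - {(2, 3), (4, 5)} = R" using RN by blast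
      then show ?thesis unfolding A Un_Diff by (simp add: insert_Diff_if) blast
    qed
    finally show ?thesis .
  qed
  have wf: "wf_digraph (with_proj (B1 m))"
    using assms(1) by unfold_locales (auto simp: B1_def)
  have "pre_digraph.digraph_isomorphism (with_proj (B1 m)) h"
    unfolding pre_digraph.digraph_isomorphism_def
    using wf inj by (auto simp: h_def intro: inj_on_subset prod.inj_map)
  moreover have "with_proj \<lparr> pverts = pverts (B1 m), parcs = parcs (B1 m) - {(2, 3), (4, 5)} \<union> {e, e'} \<rparr>
      = app_iso h (with_proj (B1 m))"
    by (simp only: app_iso_def h_def with_proj_def arcs V fV pair_pre_digraph.simps
        pre_digraph.simps digraph_isomorphism.simps)
  ultimately show ?thesis unfolding digraph_iso_def by (intro exI conjI)
qed

end

theory Submission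
  imports Defs
begin

text \<open>
  Twice the Zagreb index counts, over all ordered pairs of arcs, the tails and the heads they share.
  Split the arc set into a perfect matching \<open>M\<close> and the remaining set \<open>F\<close> of \<open>m + 1\<close> arcs. The count
  then equals \<open>m\<^sup>2 + 9 m + 6 - 2 L - N\<close>, where \<open>L\<close> is the number of ends of arcs of \<open>F\<close> that play the
  opposite role in \<open>M\<close> (a tail in \<open>F\<close> but a head in \<open>M\<close>, or conversely), and \<open>N\<close> is the number of
  ordered pairs of arcs in \<open>F\<close> with different tails and different heads. So it remains to see that
  \<open>2 L + N \<ge> 4\<close>. If the arcs of \<open>F\<close> have neither a common tail nor a common head, then
  \<open>N \<ge> 6\<close>, or else \<open>m = 3\<close>, \<open>N \<ge> 4\<close> and \<open>L \<ge> 1\<close>. If they all start in \<open>c\<close>, then \<open>N = 0\<close>; at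
  most \<open>m - 1\<close> of their \<open>m + 1\<close> heads can be heads in \<open>M\<close>, so \<open>L \<ge> 2\<close>, and equality determines the
  digraph. A common head is the same situation after reversing all arcs.
\<close>

section \<open>Counting common tails and heads over pairs of arcs\<close>

definition shared_ends :: "'a \<times> 'a \<Rightarrow> 'a \<times> 'a \<Rightarrow> int" where
  "shared_ends a b = of_bool (fst a = fst b) + of_bool (snd a = snd b)"

definition zagreb_sum :: "('a \<times> 'a) set \<Rightarrow> int" where
  "zagreb_sum A = (\<Sum>a\<in>A. \<Sum>b\<in>A. shared_ends a b)"

text \<open>Tails are compared with tails and heads with heads only: the head of one arc may be the
  tail of the other. The pairs are ordered, so each unordered one counts twice.\<close>

definition disjoint_pairs :: "('a \<times> 'a) set \<Rightarrow> (('a \<times> 'a) \<times> 'a \<times> 'a) set" where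
  "disjoint_pairs F = {(a, b). a \<in> F \<and> b \<in> F \<and> fst a \<noteq> fst b \<and> snd a \<noteq> snd b}"

lemma disjoint_pairs_subset: "disjoint_pairs F \<subseteq> F \<times> F"
  by (auto simp: disjoint_pairs_def)

text \<open>An arc shares two ends with itself, and distinct arcs share one end or none. So every
  pair contributes 1, plus 1 on the diagonal, minus 1 if it is disjoint.\<close>

lemma zagreb_sum_eq_card:
  assumes "finite F"
  shows "zagreb_sum F = int (card F) * (int (card F) + 1) - int (card (disjoint_pairs F))"
proof -
  have w: "shared_ends a b = 1 + of_bool (a = b) - of_bool (fst a \<noteq> fst b \<and> snd a \<noteq> snd b)"
    for a b :: "'a \<times> 'a"
    by (auto simp: shared_ends_def prod_eq_iff)
  have "(\<Sum>a\<in>F. \<Sum>b\<in>F. of_bool (fst a \<noteq> fst b \<and> snd a \<noteq> snd b) :: int)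
      = (\<Sum>(a, b)\<in>F \<times> F. of_bool (fst a \<noteq> fst b \<and> snd a \<noteq> snd b))"
    by (rule sum.cartesian_product)
  also have "\<dots> = (\<Sum>p\<in>F \<times> F. of_bool (p \<in> disjoint_pairs F))"
    by (rule sum.cong) (auto simp: disjoint_pairs_def)
  also have "\<dots> = int (card (disjoint_pairs F))"
  proof -
    have "(F \<times> F) \<inter> {p. p \<in> disjoint_pairs F} = disjoint_pairs F"
      using disjoint_pairs_subset[of F] by auto
    then show ?thesis using assms by simp
  qed
  finally have N: "(\<Sum>a\<in>F. \<Sum>b\<in>F. of_bool (fst a \<noteq> fst b \<and> snd a \<noteq> snd b) :: int)
    = int (card (disjoint_pairs F))" .
  have "(\<Sum>a\<in>F. \<Sum>b\<in>F. of_bool (a = b) :: int) = (\<Sum>a\<in>F. 1)"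
  proof (rule sum.cong[OF refl])
    fix a assume "a \<in> F"
    then have "F \<inter> {b. a = b} = {a}" by auto
    then show "(\<Sum>b\<in>F. of_bool (a = b) :: int) = 1" using assms by simp
  qed
  then show ?thesis
    unfolding zagreb_sum_def w sum.distrib sum_subtractf N by (simp add: algebra_simps)
qed

lemma zagreb_sum_converse: "zagreb_sum (A\<inverse>) = zagreb_sum A"
proof -
  have c: "A\<inverse> = prod.swap ` A" by force
  have "inj_on prod.swap A" by simp
  then show ?thesis
    unfolding zagreb_sum_def c by (simp add: sum.reindex shared_ends_def add.commute)
qed

lemma zagreb_sum_map_prod:
  assumes "inj_on f V" "A \<subseteq> V \<times> V"
  shows "zagreb_sum (map_prod f f ` A) = zagreb_sum A"
proof -
  have "inj_on (map_prod f f) A"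
    using assms by (intro inj_on_subset[OF map_prod_inj_on])
  moreover have "shared_ends (map_prod f f a) (map_prod f f b) = shared_ends a b"
    if "a \<in> A" "b \<in> A" for a b
  proof -
    have "fst a \<in> V" "snd a \<in> V" "fst b \<in> V" "snd b \<in> V" using that assms(2) by auto
    then show ?thesis using assms(1) by (simp add: shared_ends_def inj_on_eq_iff)
  qed
  ultimately show ?thesis
    unfolding zagreb_sum_def by (simp add: sum.reindex)
qed

text \<open>For fixed \<open>a\<close>, summing over \<open>b\<close> counts the arcs leaving
  \<open>fst a\<close> and those entering \<open>snd a\<close>.\<close>

lemma first_zagreb_eq_zagreb_sum:
  assumes "finite (parcs D)"
  shows "first_zagreb D = 1 / 2 * real_of_int (zagreb_sum (parcs D))"
proof -
  let ?A = "parcs D"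
  have "real (out_degree (with_proj D) (fst a)) + real (in_degree (with_proj D) (snd a))
      = real_of_int (\<Sum>b\<in>?A. shared_ends a b)" for a
  proof -
    have "out_arcs (with_proj D) (fst a) = ?A \<inter> {b. fst a = fst b}"
      "in_arcs (with_proj D) (snd a) = ?A \<inter> {b. snd a = snd b}"
      by (auto simp: out_arcs_def in_arcs_def)
    then show ?thesis
      using assms by (simp add: shared_ends_def sum.distrib out_degree_def in_degree_def)
  qed
  then show ?thesis
    by (simp add: first_zagreb_def zagreb_sum_def case_prod_beta)
qed

section \<open>Stars and disjoint pairs in small arc sets\<close>

lemma star_or_disjoint_arcs:
  fixes F :: "('a \<times> 'a) set"
  obtains c where "F \<subseteq> {c} \<times> UNIV" | c where "F \<subseteq> UNIV \<times> {c}"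
    | a b where "a \<in> F" "b \<in> F" "fst a \<noteq> fst b" "snd a \<noteq> snd b"
proof -
  consider a b where "a \<in> F" "b \<in> F" "fst a \<noteq> fst b" "snd a \<noteq> snd b"
    | "\<forall>a\<in>F. \<forall>b\<in>F. fst a = fst b \<or> snd a = snd b" by blast
  then show thesis
  proof cases
    case 1 then show ?thesis using that(3) by blast
  next
    case 2
    show ?thesis
    proof (cases "\<exists>a\<in>F. \<exists>b\<in>F. fst a \<noteq> fst b")
      case False
      \<comment> \<open>\<open>SOME\<close> supplies a centre even for empty \<open>F\<close>, where
        any vertex will do.\<close>
      then have "F \<subseteq> {fst (SOME a. a \<in> F)} \<times> UNIV"
        by (metis (mono_tags, lifting) SigmaI UNIV_I insertI1 prod.collapse someI_ex subsetI)
      then show ?thesis using that(1) by blast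
    next
      case True
      then obtain a b where ab: "a \<in> F" "b \<in> F" "fst a \<noteq> fst b" by blast
      \<comment> \<open>A third arc \<open>d\<close> differs in its tail from \<open>a\<close> or
        from \<open>b\<close>, so it shares its head with one of them; \<open>a\<close> and
        \<open>b\<close> already share theirs.\<close>
      have "F \<subseteq> UNIV \<times> {snd a}"
      proof
        fix d assume "d \<in> F"
        then have "snd d = snd a" using 2 ab by metis
        then show "d \<in> UNIV \<times> {snd a}" by (cases d) auto
      qed
      then show ?thesis using that(2) by blast
    qed
  qed
qed

lemma six_le_card_disjoint_pairsI:
  assumes fin: "finite F"
    and pq: "{(p1, q1), (p2, q2), (p3, q3)} \<subseteq> disjoint_pairs F"
    and ne: "{p1, q1} \<noteq> {p2, q2}" "{p1, q1} \<noteq> {p3, q3}" "{p2, q2} \<noteq> {p3, q3}"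
  shows "6 \<le> card (disjoint_pairs F)"
proof -
  let ?P = "{(p1, q1), (q1, p1), (p2, q2), (q2, p2), (p3, q3), (q3, p3)}"
  have "p1 \<noteq> q1" "p2 \<noteq> q2" "p3 \<noteq> q3" using pq by (auto simp: disjoint_pairs_def)
  then have "card ?P = 6" using ne by (auto simp: doubleton_eq_iff card_insert_if)
  moreover have "?P \<subseteq> disjoint_pairs F" using pq by (auto simp: disjoint_pairs_def)
  moreover have "finite (disjoint_pairs F)"
    using fin finite_subset[OF disjoint_pairs_subset] by blast
  ultimately show ?thesis by (metis card_mono)
qed

text \<open>Besides \<open>a\<close> and \<open>b\<close>, only the arcs \<open>(fst a, snd b)\<close> and \<open>(fst b, snd a)\<close> meet both of them,
  and these two are disjoint themselves.\<close>

lemma six_le_card_disjoint_pairs: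
  assumes fin: "finite F" and F: "card F \<ge> 5"
    and ab: "a \<in> F" "b \<in> F" "fst a \<noteq> fst b" "snd a \<noteq> snd b"
  shows "6 \<le> card (disjoint_pairs F)"
proof -
  let ?c = "(fst a, snd b)" and ?d = "(fst b, snd a)"
  have miss: "\<exists>x\<in>{a, b}. fst e \<noteq> fst x \<and> snd e \<noteq> snd x" if "e \<notin> {a, b, ?c, ?d}" for e
    using that ab(3,4) by (cases a; cases b; cases e) auto
  have new: "\<exists>e. e \<in> F \<and> e \<notin> {s, t, u, v}" for s t u v
  proof (rule ccontr)
    assume "\<not> ?thesis"
    then have "F \<subseteq> set [s, t, u, v]" by auto
    then have "card F \<le> card (set [s, t, u, v])" by (intro card_mono) auto
    also have "\<dots> \<le> 4" using card_length[of "[s, t, u, v]"] by simp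
    finally show False using F by simp
  qed
  obtain e where e: "e \<in> F" "e \<notin> {a, b, ?c, ?d}" using new by blast
  obtain x where x: "x \<in> {a, b}" "fst e \<noteq> fst x" "snd e \<noteq> snd x" using miss[OF e(2)] by blast
  show ?thesis
  proof (cases "?c \<in> F \<and> ?d \<in> F")
    case True
    show ?thesis
    proof (rule six_le_card_disjoint_pairsI[OF fin])
      show "{(a, b), (?c, ?d), (e, x)} \<subseteq> disjoint_pairs F"
        using ab e x True by (auto simp: disjoint_pairs_def)
      show "{a, b} \<noteq> {?c, ?d}" using ab by (auto simp: doubleton_eq_iff prod_eq_iff)
      show "{a, b} \<noteq> {e, x}" "{?c, ?d} \<noteq> {e, x}" using e(2) by (auto simp: doubleton_eq_iff)
    qed
  next
    case False
    \<comment> \<open>At most one of \<open>?c\<close> and \<open>?d\<close> lies in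
      \<open>F\<close>, and \<open>z\<close> is that one if it exists. Avoiding the four arcs
      \<open>a\<close>, \<open>b\<close>, \<open>z\<close>, \<open>e\<close>, as five arcs allow,
      thus keeps \<open>g\<close> away from both corners.\<close>
    define z where "z = (if ?c \<in> F then ?c else ?d)"
    have z: "F \<inter> {?c, ?d} \<subseteq> {z}" using False by (auto simp: z_def)
    obtain g where g: "g \<in> F" "g \<notin> {a, b, z, e}" using new by blast
    then have "g \<notin> {a, b, ?c, ?d}" using z by blast
    from miss[OF this] obtain u where u: "u \<in> {a, b}" "fst g \<noteq> fst u" "snd g \<noteq> snd u" by blast
    show ?thesis
    proof (rule six_le_card_disjoint_pairsI[OF fin])
      show "{(a, b), (e, x), (g, u)} \<subseteq> disjoint_pairs F"
        using ab e x g u by (auto simp: disjoint_pairs_def)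
      show "{a, b} \<noteq> {e, x}" "{a, b} \<noteq> {g, u}" "{e, x} \<noteq> {g, u}" using e(2) g(2) u(1)
        by (auto simp: doubleton_eq_iff)
    qed
  qed
qed

text \<open>An arc outside the rectangle spanned by \<open>a\<close> and \<open>b\<close> misses one
  of them and yields a second pair. Otherwise \<open>F\<close> is the whole rectangle, and its other
  diagonal is the second pair.\<close>

lemma four_le_card_disjoint_pairs:
  assumes fin: "finite F" and F: "card F \<ge> 4"
    and ab: "a \<in> F" "b \<in> F" "fst a \<noteq> fst b" "snd a \<noteq> snd b"
  shows "4 \<le> card (disjoint_pairs F)"
proof -
  have four: "4 \<le> card (disjoint_pairs F)"
    if pq: "{(p, q), (p', q')} \<subseteq> disjoint_pairs F" and ne: "{p, q} \<noteq> {p', q'}" for p q p' q'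
  proof -
    let ?P = "{(p, q), (q, p), (p', q'), (q', p')}"
    have "p \<noteq> q" "p' \<noteq> q'" using pq by (auto simp: disjoint_pairs_def)
    then have "card ?P = 4" using ne by (auto simp: doubleton_eq_iff card_insert_if)
    moreover have "?P \<subseteq> disjoint_pairs F" using pq by (auto simp: disjoint_pairs_def)
    moreover have "finite (disjoint_pairs F)"
      using fin finite_subset[OF disjoint_pairs_subset] by blast
    ultimately show ?thesis by (metis card_mono)
  qed
  let ?c = "(fst a, snd b)" and ?d = "(fst b, snd a)"
  have meets: "e \<in> {?c, ?d}" if "e \<notin> {a, b}" "\<forall>x\<in>{a, b}. fst e = fst x \<or> snd e = snd x" for e
    using that ab(3,4) by (cases a; cases b; cases e) auto
  show ?thesis
  proof (cases "\<exists>e\<in>F. e \<notin> {a, b, ?c, ?d}")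
    case True
    then obtain e where e: "e \<in> F" "e \<notin> {a, b}" "e \<notin> {?c, ?d}" by blast
    then obtain x where x: "x \<in> {a, b}" "fst e \<noteq> fst x" "snd e \<noteq> snd x" using meets by blast
    show ?thesis
    proof (rule four)
      show "{(a, b), (e, x)} \<subseteq> disjoint_pairs F"
        using ab e(1) x by (auto simp: disjoint_pairs_def)
      show "{a, b} \<noteq> {e, x}" using e(2) by (auto simp: doubleton_eq_iff)
    qed
  next
    case False
    then have "F \<subseteq> {a, b, ?c, ?d}" by blast
    moreover have "card {a, b, ?c, ?d} \<le> 4" by (simp add: card_insert_if)
    ultimately have "F = {a, b, ?c, ?d}" using F by (intro card_seteq) auto
    then have cd: "?c \<in> F" "?d \<in> F" by auto
    show ?thesis
    proof (rule four)
      show "{(a, b), (?c, ?d)} \<subseteq> disjoint_pairs F"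
        using ab cd by (auto simp: disjoint_pairs_def)
      show "{a, b} \<noteq> {?c, ?d}" using ab by (auto simp: doubleton_eq_iff prod_eq_iff)
    qed
  qed
qed

section \<open>Arc sets split by a perfect matching\<close>

text \<open>The conditions on \<open>fst\<close> and \<open>snd\<close> say that the arcs of
  \<open>M\<close> have \<open>2 * m\<close> distinct ends. A bicyclic graph on these vertices has
  \<open>2 * m + 1\<close> edges, which leaves \<open>m + 1\<close> arcs outside
  \<open>M\<close>.\<close>

locale arc_matching =
  fixes A M :: "('a \<times> 'a) set" and m :: nat
  assumes fin: "finite A" and MA: "M \<subseteq> A"
    and inj_fst: "inj_on fst M" and inj_snd: "inj_on snd M" and disj: "fst ` M \<inter> snd ` M = {}"
    and cardM: "card M = m" and cardF: "card (A - M) = m + 1"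
begin

abbreviation F where "F \<equiv> A - M"

text \<open>If \<open>M\<close> covers all vertices, an end that does not occur in \<open>M\<close>
  in its own role occurs there in the opposite one, so this is the \<open>L\<close> of the
  overview.\<close>

definition defect :: int where
  "defect = (\<Sum>a\<in>F. of_bool (fst a \<notin> fst ` M) + of_bool (snd a \<notin> snd ` M))"

lemma finM: "finite M" using fin MA finite_subset by blast

lemma finF: "finite F" using fin by blast

lemma sum_shared_ends_matching:
  "(\<Sum>b\<in>M. shared_ends a b) = of_bool (fst a \<in> fst ` M) + of_bool (snd a \<in> snd ` M)"
proof -
  have "(\<Sum>b\<in>M. of_bool (fst a = fst b)) = (\<Sum>x\<in>fst ` M. of_bool (fst a = x) :: int)"
    using inj_fst by (simp only: sum.reindex o_def)
  also have "\<dots> = of_bool (fst a \<in> fst ` M)"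
    using finM by (simp only: of_bool_def sum.delta' finite_imageI)
  finally have 1: "(\<Sum>b\<in>M. of_bool (fst a = fst b)) = (of_bool (fst a \<in> fst ` M) :: int)" .
  have "(\<Sum>b\<in>M. of_bool (snd a = snd b)) = (\<Sum>x\<in>snd ` M. of_bool (snd a = x) :: int)"
    using inj_snd by (simp only: sum.reindex o_def)
  also have "\<dots> = of_bool (snd a \<in> snd ` M)"
    using finM by (simp only: of_bool_def sum.delta' finite_imageI)
  finally have 2: "(\<Sum>b\<in>M. of_bool (snd a = snd b)) = (of_bool (snd a \<in> snd ` M) :: int)" .
  show ?thesis unfolding shared_ends_def sum.distrib 1 2 ..
qed

text \<open>Pairs inside \<open>M\<close> contribute \<open>2 * m\<close>, mixed pairs twice
  \<open>2 * (m + 1) - defect\<close>, and pairs inside \<open>F\<close> contribute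
  \<open>(m + 1) * (m + 2)\<close> minus the number of disjoint ones.\<close>

lemma zagreb_sum_eq:
  "zagreb_sum A = int m ^ 2 + 9 * int m + 6 - 2 * defect - int (card (disjoint_pairs F))"
proof -
  have sym: "shared_ends a b = shared_ends b a" for a b :: "'a \<times> 'a"
    by (auto simp: shared_ends_def)
  have A: "A = M \<union> F" "M \<inter> F = {}" using MA by auto
  have un: "(\<Sum>a\<in>A. f a) = (\<Sum>a\<in>M. f a) + (\<Sum>a\<in>F. f a)" for f :: "'a \<times> 'a \<Rightarrow> int"
    by (subst A(1), rule sum.union_disjoint[OF finM finF A(2)])
  have MM: "(\<Sum>a\<in>M. \<Sum>b\<in>M. shared_ends a b) = 2 * int m"
  proof -
    have "(\<Sum>a\<in>M. \<Sum>b\<in>M. shared_ends a b) = (\<Sum>a\<in>M. 2)"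
      by (rule sum.cong) (auto simp: sum_shared_ends_matching)
    then show ?thesis using cardM by simp
  qed
  have FM: "(\<Sum>a\<in>F. \<Sum>b\<in>M. shared_ends a b) = 2 * (int m + 1) - defect"
  proof -
    have "(\<Sum>a\<in>F. \<Sum>b\<in>M. shared_ends a b)
        = (\<Sum>a\<in>F. 2 - (of_bool (fst a \<notin> fst ` M) + of_bool (snd a \<notin> snd ` M)))"
      by (rule sum.cong) (auto simp: sum_shared_ends_matching)
    then show ?thesis unfolding sum_subtractf defect_def using cardF by simp
  qed
  have MF: "(\<Sum>a\<in>M. \<Sum>b\<in>F. shared_ends a b) = 2 * (int m + 1) - defect"
    unfolding FM[symmetric] by (subst sum.swap) (simp add: sym)
  have "zagreb_sum A = 2 * int m + 2 * (2 * (int m + 1) - defect) + zagreb_sum F"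
    unfolding zagreb_sum_def un sum.distrib MM FM MF by simp
  then show ?thesis
    unfolding zagreb_sum_eq_card[OF finF] cardF by (simp add: power2_eq_square algebra_simps)
qed

lemma defect_nonneg: "0 \<le> defect"
  unfolding defect_def by (rule sum_nonneg) simp

text \<open>Four arcs alone guarantee only four disjoint pairs. Zero defect makes each arc of
  \<open>F\<close> run from the tail of one matching arc to the head of another, and three matching
  arcs are too few for the configurations with fewer than six pairs.\<close>

lemma no_defect_six_disjoint_pairs:
  assumes m: "m = 3" and L: "defect = 0"
    and ab: "a \<in> F" "b \<in> F" "fst a \<noteq> fst b" "snd a \<noteq> snd b"
  shows "6 \<le> card (disjoint_pairs F)"
proof -
  have ends: "fst e \<in> fst ` M" "snd e \<in> snd ` M" if "e \<in> F" for e
  proof -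
    have "of_bool (fst e \<notin> fst ` M) + of_bool (snd e \<notin> snd ` M) = (0 :: int)"
      using L that finF unfolding defect_def by (subst (asm) sum_nonneg_eq_0_iff) simp_all
    then show "fst e \<in> fst ` M" "snd e \<in> snd ` M" by (auto split: if_splits simp: of_bool_def)
  qed
  \<comment> \<open>\<open>t\<close> and \<open>h\<close> find the matching arc with a given tail or
    head. On the two ends of an arc of \<open>F\<close> they disagree, since otherwise that arc
    would lie in \<open>M\<close>.\<close>
  define t where "t = the_inv_into M fst"
  define h where "h = the_inv_into M snd"
  have t: "t (fst e) \<in> M" "fst (t (fst e)) = fst e"
    and h: "h (snd e) \<in> M" "snd (h (snd e)) = snd e" if "e \<in> F" for e
    unfolding t_def h_def
    using the_inv_into_into[OF inj_fst ends(1)[OF that] subset_refl]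
      f_the_inv_into_f[OF inj_fst ends(1)[OF that]]
      the_inv_into_into[OF inj_snd ends(2)[OF that] subset_refl]
      f_the_inv_into_f[OF inj_snd ends(2)[OF that]] by auto
  have th: "t (fst e) \<noteq> h (snd e)" if "e \<in> F" for e
  proof
    assume eq: "t (fst e) = h (snd e)"
    then have "t (fst e) = e" using t(2)[OF that] h(2)[OF that] by (intro prod_eqI) simp_all
    then show False using t(1)[OF that] that by simp
  qed
  have teq: "t (fst e) = t (fst e') \<longleftrightarrow> fst e = fst e'" if "e \<in> F" "e' \<in> F" for e e'
    using t(2)[OF that(1)] t(2)[OF that(2)] by metis
  have heq: "h (snd e) = h (snd e') \<longleftrightarrow> snd e = snd e'" if "e \<in> F" "e' \<in> F" for e e'
    using h(2)[OF that(1)] h(2)[OF that(2)] by metis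
  have few: False if "distinct [w, x, y, z]" "set [w, x, y, z] \<subseteq> M" for w x y z
    using card_mono[OF finM that(2)] distinct_card[OF that(1)] cardM m by simp
  \<comment> \<open>A tail with three heads would need its own matching arc and one for each head,
    four in all; \<open>in3\<close> is the dual.\<close>
  have out3: False
    if e: "e1 \<in> F" "e2 \<in> F" "e3 \<in> F" "fst e1 = fst e2" "fst e1 = fst e3"
      and ne: "snd e1 \<noteq> snd e2" "snd e1 \<noteq> snd e3" "snd e2 \<noteq> snd e3" for e1 e2 e3
    using few[of "t (fst e1)" "h (snd e1)" "h (snd e2)" "h (snd e3)"] e(4,5) ne
      th[OF e(1)] th[OF e(2)] th[OF e(3)] t(1)[OF e(1)] h(1)[OF e(1)] h(1)[OF e(2)] h(1)[OF e(3)]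
      heq[OF e(1,2)] heq[OF e(1,3)] heq[OF e(2,3)] by simp
  have in3: False
    if e: "e1 \<in> F" "e2 \<in> F" "e3 \<in> F" "snd e1 = snd e2" "snd e1 = snd e3"
      and ne: "fst e1 \<noteq> fst e2" "fst e1 \<noteq> fst e3" "fst e2 \<noteq> fst e3" for e1 e2 e3
    using few[of "h (snd e1)" "t (fst e1)" "t (fst e2)" "t (fst e3)"] e(4,5) ne
      th[OF e(1)] th[OF e(2)] th[OF e(3)] h(1)[OF e(1)] t(1)[OF e(1)] t(1)[OF e(2)] t(1)[OF e(3)]
      teq[OF e(1,2)] teq[OF e(1,3)] teq[OF e(2,3)] by (simp add: eq_commute)
  \<comment> \<open>The arc \<open>e\<close> misses \<open>a\<close> or \<open>b\<close>. If it
    misses \<open>a\<close>, it also misses the corner \<open>(fst a, snd b)\<close>, unless its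
    head is \<open>snd b\<close>, which \<open>in3\<close> forbids; the case of \<open>b\<close> is
    dual. Hence \<open>e\<close> is disjoint from two of the three arcs.\<close>
  have diag: "6 \<le> card (disjoint_pairs F)"
    if a: "a \<in> F" and b: "b \<in> F" and ne: "fst a \<noteq> fst b" "snd a \<noteq> snd b"
      and c: "(fst a, snd b) \<in> F" and e: "e \<in> F" "e \<notin> {a, b, (fst a, snd b), (fst b, snd a)}"
    for a b e
  proof -
    let ?c = "(fst a, snd b)"
    have sixI: "6 \<le> card (disjoint_pairs F)" if "x \<in> {a, b, ?c}" "y \<in> {a, b, ?c}" "x \<noteq> y"
      "fst e \<noteq> fst x" "snd e \<noteq> snd x" "fst e \<noteq> fst y" "snd e \<noteq> snd y" for x y
    proof (rule six_le_card_disjoint_pairsI[OF finF])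
      show "{(a, b), (e, x), (e, y)} \<subseteq> disjoint_pairs F"
        using a b c e(1) ne that by (auto simp: disjoint_pairs_def)
      show "{a, b} \<noteq> {e, x}" "{a, b} \<noteq> {e, y}" "{e, x} \<noteq> {e, y}"
        using e(2) that by (auto simp: doubleton_eq_iff)
    qed
    have ac: "a \<noteq> ?c" "b \<noteq> ?c" "a \<noteq> b" using ne by (auto simp: prod_eq_iff)
    consider "fst e \<noteq> fst a" "snd e \<noteq> snd a" | "fst e \<noteq> fst b" "snd e \<noteq> snd b"
      using e(2) ne by (cases a; cases b; cases e) auto
    then show ?thesis
    proof cases
      case 1
      show ?thesis
      proof (cases "snd e = snd b")
        case True
        then have *: "fst e \<noteq> fst b" using e(2) by (auto simp: prod_eq_iff)
        have False
        proof (rule in3[OF c b e(1)])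
          show "snd ?c = snd b" "fst ?c \<noteq> fst b" using ne(1) by simp_all
          show "snd ?c = snd e" "fst ?c \<noteq> fst e" "fst b \<noteq> fst e" using True * 1(1) by simp_all
        qed
        then show ?thesis ..
      next
        case False
        show ?thesis by (rule sixI[OF _ _ ac(1)]) (use 1 False in simp_all)
      qed
    next
      case 2
      show ?thesis
      proof (cases "fst e = fst a")
        case True
        then have *: "snd e \<noteq> snd a" using e(2) by (auto simp: prod_eq_iff)
        have False
        proof (rule out3[OF a c e(1)])
          show "fst a = fst ?c" "snd a \<noteq> snd ?c" using ne(2) by simp_all
          show "fst a = fst e" "snd a \<noteq> snd e" "snd ?c \<noteq> snd e" using True * 2(2) by simp_all
        qed
        then show ?thesis ..
      next
        case False
        show ?thesis by (rule sixI[OF _ _ ac(2)]) (use 2 False in simp_all)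
      qed
    qed
  qed
  let ?c = "(fst a, snd b)" and ?d = "(fst b, snd a)"
  have card4: "card F = 4" using cardF m by simp
  have new: "\<exists>e. e \<in> F \<and> e \<notin> {s, t, u}" for s t u
  proof (rule ccontr)
    assume "\<not> ?thesis"
    then have "F \<subseteq> set [s, t, u]" by auto
    then have "card F \<le> card (set [s, t, u])" by (intro card_mono) auto
    also have "\<dots> \<le> 3" using card_length[of "[s, t, u]"] by simp
    finally show False using card4 by simp
  qed
  have miss: "\<exists>x\<in>{a, b}. fst e \<noteq> fst x \<and> snd e \<noteq> snd x" if "e \<notin> {a, b, ?c, ?d}" for e
    using that ab(3,4) by (cases a; cases b; cases e) auto
  show ?thesis
  proof (cases "\<exists>e\<in>F. e \<notin> {a, b, ?c, ?d}")
    case True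
    then obtain e where e: "e \<in> F" "e \<notin> {a, b, ?c, ?d}" by blast
    obtain g where g: "g \<in> F" "g \<notin> {a, b, e}" using new by blast
    consider "g = ?c" | "g = ?d" | "g \<notin> {a, b, ?c, ?d}" using g by blast
    then show ?thesis
    proof cases
      case 1
      then show ?thesis using diag[OF ab _ e] g by blast
    next
      case 2
      \<comment> \<open>Exchanging \<open>a\<close> and \<open>b\<close> turns the corner
        \<open>?d\<close> into \<open>?c\<close>.\<close>
      then show ?thesis using diag[of b a e] ab e g by auto
    next
      case 3
      obtain x where x: "x \<in> {a, b}" "fst e \<noteq> fst x" "snd e \<noteq> snd x" using miss[OF e(2)] by blast
      obtain u where u: "u \<in> {a, b}" "fst g \<noteq> fst u" "snd g \<noteq> snd u" using miss[OF 3] by blast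
      show ?thesis
      proof (rule six_le_card_disjoint_pairsI[OF finF])
        show "{(a, b), (e, x), (g, u)} \<subseteq> disjoint_pairs F"
          using ab e(1) x g(1) u by (auto simp: disjoint_pairs_def)
        show "{a, b} \<noteq> {e, x}" "{a, b} \<noteq> {g, u}" "{e, x} \<noteq> {g, u}"
          using e(2) g(2) u(1) by (auto simp: doubleton_eq_iff)
      qed
    qed
  next
    case False
    then have "F \<subseteq> {a, b, ?c, ?d}" by blast
    moreover have "card {a, b, ?c, ?d} \<le> 4" by (simp add: card_insert_if)
    ultimately have "F = {a, b, ?c, ?d}" using card4 by (intro card_seteq) auto
    then have cd: "?c \<in> F" "?d \<in> F" by auto
    \<comment> \<open>The full rectangle would need four different matching arcs, for its two tails
      and its two heads.\<close>
    have False
    proof (rule few)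
      show "distinct [t (fst a), t (fst b), h (snd a), h (snd b)]"
        using th[OF ab(1)] th[OF ab(2)] th[OF cd(1)] th[OF cd(2)] teq[OF ab(1,2)] heq[OF ab(1,2)] ab(3,4)
        by simp
      show "set [t (fst a), t (fst b), h (snd a), h (snd b)] \<subseteq> M"
        using t(1)[OF ab(1)] t(1)[OF ab(2)] h(1)[OF ab(1)] h(1)[OF ab(2)] by simp
    qed
    then show ?thesis ..
  qed
qed

text \<open>From \<open>m = 4\<close> on, \<open>F\<close> has at least five arcs and thus six
  disjoint pairs. For \<open>m = 3\<close>, fewer than six still means at least four, together with
  a positive defect that counts twice.\<close>

lemma zagreb_sum_non_star:
  assumes m: "m \<ge> 3" and ab: "a \<in> F" "b \<in> F" "fst a \<noteq> fst b" "snd a \<noteq> snd b"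
  shows "zagreb_sum A < int m ^ 2 + 9 * int m + 2"
proof -
  have "4 < 2 * defect + int (card (disjoint_pairs F))"
  proof (cases "6 \<le> card (disjoint_pairs F)")
    case True
    then show ?thesis using defect_nonneg by simp
  next
    case False
    then have "m = 3" using six_le_card_disjoint_pairs[OF finF _ ab] cardF m by fastforce
    then have "defect \<noteq> 0" "4 \<le> card (disjoint_pairs F)"
      using no_defect_six_disjoint_pairs[OF _ _ ab] False
        four_le_card_disjoint_pairs[OF finF _ ab] cardF by auto
    then show ?thesis using defect_nonneg by simp
  qed
  then show ?thesis unfolding zagreb_sum_eq by simp
qed

end

section \<open>The extremal digraph up to isomorphism\<close>

text \<open>A label-free description of the extremal digraph: the perfect matching \<open>M\<close> consists of the
  pendent arc \<open>p\<close> at the centre \<open>fst p\<close>, the triangle arcs \<open>d\<close> and \<open>e\<close> opposite to the centre,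
  and the outer arcs of the attached paths.\<close>

definition windmill :: "'a set \<Rightarrow> ('a \<times> 'a) set \<Rightarrow> nat \<Rightarrow> bool" where
  "windmill V A m \<longleftrightarrow> (\<exists>M p d e. finite M \<and> card M = m \<and> inj_on fst M \<and> inj_on snd M
    \<and> fst ` M \<inter> snd ` M = {} \<and> V = fst ` M \<union> snd ` M \<and> p \<in> M \<and> d \<in> M \<and> e \<in> M
    \<and> p \<noteq> d \<and> p \<noteq> e \<and> d \<noteq> e \<and> A = M \<union> {fst p} \<times> (snd ` (M - {p}) \<union> {fst d, fst e}))"

lemma bij_betw_extend_triple:
  assumes "finite M" "card M = card M'" "p \<in> M" "d \<in> M" "e \<in> M" "p' \<in> M'" "d' \<in> M'" "e' \<in> M'"
    and "p \<noteq> d" "p \<noteq> e" "d \<noteq> e" "p' \<noteq> d'" "p' \<noteq> e'" "d' \<noteq> e'"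
  obtains g where "bij_betw g M M'" "g p = p'" "g d = d'" "g e = e'"
proof -
  have "card M > 0" using assms(1,3) by (auto simp: card_gt_0_iff)
  then have fin': "finite M'" using assms(2) card_ge_0_finite by auto
  have "card (M - {p, d, e}) = card (M' - {p', d', e'})"
    using assms by (simp add: card_Diff_subset)
  then obtain h where h: "bij_betw h (M - {p, d, e}) (M' - {p', d', e'})"
    using finite_same_card_bij assms(1) fin' by blast
  define g where "g = h(p := p', d := d', e := e')"
  have g: "g p = p'" "g d = d'" "g e = e'" using assms by (auto simp: g_def)
  have "bij_betw g (M - {p, d, e}) (M' - {p', d', e'})"
    using h by (rule bij_betw_cong[THEN iffD1, rotated]) (auto simp: g_def)
  moreover have "bij_betw g {p, d, e} {p', d', e'}"
    using g assms by (auto simp: bij_betw_def inj_on_def)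
  ultimately have "bij_betw g (M - {p, d, e} \<union> {p, d, e}) (M' - {p', d', e'} \<union> {p', d', e'})"
    by (rule bij_betw_combine) blast
  moreover have "M - {p, d, e} \<union> {p, d, e} = M" "M' - {p', d', e'} \<union> {p', d', e'} = M'"
    using assms by auto
  ultimately show thesis using that g by simp
qed

text \<open>A bijection of the matchings that respects the three named arcs induces a vertex map,
  since each vertex is an end of exactly one matching arc, in a fixed role. The map is onto a vertex
  set of the same size \<open>2 * m\<close>, hence injective.\<close>

lemma windmill_iso:
  assumes "windmill V A m" "windmill V' A' m"
  obtains f where "inj_on f V" "V' = f ` V" "A' = map_prod f f ` A"
proof -
  obtain M p d e where M: "finite M" "card M = m" and inj: "inj_on fst M" "inj_on snd M"
    and disj: "fst ` M \<inter> snd ` M = {}" and V: "V = fst ` M \<union> snd ` M"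
    and pde: "p \<in> M" "d \<in> M" "e \<in> M" "p \<noteq> d" "p \<noteq> e" "d \<noteq> e"
    and A: "A = M \<union> {fst p} \<times> (snd ` (M - {p}) \<union> {fst d, fst e})"
    using assms(1) unfolding windmill_def by blast
  obtain M' p' d' e' where M': "finite M'" "card M' = m" and inj': "inj_on fst M'" "inj_on snd M'"
    and disj': "fst ` M' \<inter> snd ` M' = {}" and V': "V' = fst ` M' \<union> snd ` M'"
    and pde': "p' \<in> M'" "d' \<in> M'" "e' \<in> M'" "p' \<noteq> d'" "p' \<noteq> e'" "d' \<noteq> e'"
    and A': "A' = M' \<union> {fst p'} \<times> (snd ` (M' - {p'}) \<union> {fst d', fst e'})"
    using assms(2) unfolding windmill_def by blast
  obtain g where g: "bij_betw g M M'" "g p = p'" "g d = d'" "g e = e'"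
    using bij_betw_extend_triple[of M M' p d e p' d' e'] M M' pde pde' by metis
  define f where "f x = (if x \<in> fst ` M then fst (g (the_inv_into M fst x))
    else snd (g (the_inv_into M snd x)))" for x
  have f1: "f (fst a) = fst (g a)" if "a \<in> M" for a
    using that inj by (simp add: f_def the_inv_into_f_f)
  have f2: "f (snd a) = snd (g a)" if "a \<in> M" for a
  proof -
    have "snd a \<notin> fst ` M" using that disj by blast
    then show ?thesis using that inj by (simp add: f_def the_inv_into_f_f)
  qed
  have gM: "g ` M = M'" using g(1) by (simp add: bij_betw_def)
  have "M' - {p'} = g ` (M - {p})"
    using g(1,2) pde(1) unfolding gM[symmetric] bij_betw_def
    by (subst inj_on_image_set_diff[of g M]) auto
  then have gMp: "snd ` (M' - {p'}) = f ` snd ` (M - {p})" by (simp add: image_image f2)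
  have fV: "V' = f ` V"
    unfolding V V' gM[symmetric] image_Un image_image by (simp add: f1 f2)
  moreover have "inj_on f V"
  proof (rule eq_card_imp_inj_on)
    show "finite V" using M V by simp
    have "card V = 2 * m"
      unfolding V using M disj inj by (subst card_Un_disjoint) (simp_all add: card_image)
    moreover have "card V' = 2 * m"
      unfolding V' using M' disj' inj' by (subst card_Un_disjoint) (simp_all add: card_image)
    ultimately show "card (f ` V) = card V" using fV by simp
  qed
  moreover have "A' = map_prod f f ` A"
  proof -
    have "map_prod f f ` M = M'"
      unfolding gM[symmetric]
      by (rule image_cong) (auto simp: f1[of "(_, _)", simplified] f2[of "(_, _)", simplified])
    moreover have "map_prod f f ` ({x} \<times> Y) = {f x} \<times> f ` Y" for x Y by auto
    ultimately show ?thesis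
      unfolding A A' gMp image_Un using f1 pde g by simp
  qed
  ultimately show thesis using that by blast
qed

section \<open>Stars and the sharp bound\<close>

context arc_matching
begin

text \<open>The tails of \<open>F\<close> all equal \<open>c\<close>, so they are misplaced together
  or not at all, while the heads are pairwise different.\<close>

lemma out_star_defect:
  assumes star: "F \<subseteq> {c} \<times> UNIV"
  shows "disjoint_pairs F = {}"
    and "defect = (int m + 1) * of_bool (c \<notin> fst ` M) + int (card (snd ` F - snd ` M))"
proof -
  have c: "fst a = c" if "a \<in> F" for a using that star by auto
  then have "fst a = fst b" if "a \<in> F" "b \<in> F" for a b using that by metis
  then show "disjoint_pairs F = {}" unfolding disjoint_pairs_def by blast
  have inj: "inj_on snd F" using c by (auto simp: inj_on_def prod_eq_iff)
  have "defect = (\<Sum>a\<in>F. of_bool (c \<notin> fst ` M)) + (\<Sum>a\<in>F. of_bool (snd a \<notin> snd ` M))"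
    unfolding defect_def sum.distrib
    by (intro arg_cong2[where f = "(+)"] sum.cong refl) (simp only: c)
  also have "(\<Sum>a\<in>F. of_bool (snd a \<notin> snd ` M)) = (\<Sum>v\<in>snd ` F. of_bool (v \<notin> snd ` M) :: int)"
    using inj by (simp only: sum.reindex o_def)
  also have "\<dots> = int (card (snd ` F \<inter> {v. v \<notin> snd ` M}))"
    using finF by (subst sum_of_bool_eq) auto
  also have "snd ` F \<inter> {v. v \<notin> snd ` M} = snd ` F - snd ` M" by blast
  finally show "defect = (int m + 1) * of_bool (c \<notin> fst ` M) + int (card (snd ` F - snd ` M))"
    using cardF by simp
qed

text \<open>No head of \<open>F\<close> is an end of the matching arc \<open>p\<close> at
  \<open>c\<close>: it would give a loop or a second arc between the ends of \<open>p\<close>. So at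
  most \<open>m - 1\<close> of the \<open>m + 1\<close> heads are heads in \<open>M\<close>.\<close>

lemma zagreb_sum_out_star:
  assumes m: "m \<ge> 3" and asym: "\<And>u v. (u, v) \<in> A \<Longrightarrow> (v, u) \<notin> A"
    and cover: "fst ` A \<union> snd ` A \<subseteq> fst ` M \<union> snd ` M"
    and star: "F \<subseteq> {c} \<times> UNIV"
  shows "zagreb_sum A \<le> int m ^ 2 + 9 * int m + 2"
    and "zagreb_sum A = int m ^ 2 + 9 * int m + 2 \<Longrightarrow> windmill (fst ` M \<union> snd ` M) A m"
proof -
  define T where "T = snd ` F"
  have FT: "F = {c} \<times> T" using star by (force simp: T_def)
  have finT: "finite T" using finF by (simp add: T_def)
  have cardT: "card T = m + 1" using cardF unfolding FT by (simp add: card_cartesian_product)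
  have "T \<noteq> {}" using cardT by auto
  then obtain v0 where "(c, v0) \<in> A" using FT by blast
  then have "c \<in> fst ` M \<union> snd ` M" using cover by force
  then obtain p where p: "p \<in> M" "c = fst p \<or> c = snd p" by auto
  have pT: "v \<noteq> fst p" "v \<noteq> snd p" if "v \<in> T" for v
  proof -
    have cv: "(c, v) \<in> A" "(c, v) \<notin> M" using that FT by auto
    then have "c \<noteq> v" "(v, c) \<notin> M" using asym MA by blast+
    then show "v \<noteq> fst p" "v \<noteq> snd p" using cv p by (metis prod.collapse)+
  qed
  have TV: "T \<subseteq> fst ` M \<union> snd ` M"
  proof
    fix v assume "v \<in> T"
    then have "(c, v) \<in> A" using FT by auto
    then show "v \<in> fst ` M \<union> snd ` M" using cover by force
  qed
  have TF: "T - snd ` M = T \<inter> fst ` M" using TV disj by blast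
  have sub: "T \<inter> snd ` M \<subseteq> snd ` (M - {p})" using pT by blast
  have cardp: "card (snd ` (M - {p})) = m - 1"
    using p inj_snd cardM finM by (simp add: card_image inj_on_diff)
  have "card (T \<inter> snd ` M) \<le> m - 1"
    using card_mono[OF _ sub] finM cardp by simp
  moreover have "card T = card (T - snd ` M) + card (T \<inter> snd ` M)"
    using finT by (metis card_Diff_subset_Int card_mono finite_Int inf_le1 le_add_diff_inverse2)
  ultimately have two: "2 \<le> card (T - snd ` M)"
    and eq: "card (T - snd ` M) = 2 \<Longrightarrow> card (T \<inter> snd ` M) = m - 1"
    using cardT m by linarith+
  note defect = out_star_defect[OF star, folded T_def]
  have "2 \<le> defect" unfolding defect(2) using two by (simp add: of_bool_def)
  then show "zagreb_sum A \<le> int m ^ 2 + 9 * int m + 2"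
    unfolding zagreb_sum_eq defect(1) by simp
  show "windmill (fst ` M \<union> snd ` M) A m" if "zagreb_sum A = int m ^ 2 + 9 * int m + 2"
  proof -
    have "defect = 2" using that unfolding zagreb_sum_eq defect(1) by simp
    \<comment> \<open>A misplaced centre would contribute \<open>m + 1\<close>, more than the whole
      defect, so two misplaced heads account for all of it.\<close>
    then have c: "c \<in> fst ` M" and T2: "card (T \<inter> fst ` M) = 2"
      unfolding defect(2) using two m by (auto simp: of_bool_def TF split: if_splits)
    have cp: "c = fst p" using c p disj by auto
    have Tsnd: "T \<inter> snd ` M = snd ` (M - {p})"
      using sub eq T2 cardp finM by (intro card_subset_eq) (auto simp: TF)
    obtain x y where xy: "T \<inter> fst ` M = {x, y}" "x \<noteq> y" using T2 by (meson card_2_iff)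
    then obtain d e where de: "d \<in> M" "e \<in> M" "x = fst d" "y = fst e" by blast
    have "x \<in> T" "y \<in> T" using xy by blast+
    then have pde: "p \<noteq> d" "p \<noteq> e" "d \<noteq> e" using pT de xy by auto
    have T_eq: "T = snd ` (M - {p}) \<union> {fst d, fst e}"
    proof -
      have "T = (T \<inter> snd ` M) \<union> (T \<inter> fst ` M)" using TV by blast
      then show ?thesis unfolding Tsnd xy(1) de .
    qed
    have A_eq: "A = M \<union> {fst p} \<times> (snd ` (M - {p}) \<union> {fst d, fst e})"
      unfolding T_eq[symmetric] cp[symmetric] FT[symmetric] using MA by blast
    show ?thesis
      unfolding windmill_def
      by (intro exI[of _ M] exI[of _ p] exI[of _ d] exI[of _ e] conjI)
        (fact finM cardM inj_fst inj_snd disj refl p de pde A_eq)+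
  qed
qed

lemma arc_matching_converse: "arc_matching (A\<inverse>) (M\<inverse>) m"
proof
  have s: "M\<inverse> = prod.swap ` M" "A\<inverse> - M\<inverse> = prod.swap ` F" by force+
  show "finite (A\<inverse>)" "M\<inverse> \<subseteq> A\<inverse>" using fin MA by auto
  show "card (M\<inverse>) = m" "card (A\<inverse> - M\<inverse>) = m + 1"
    unfolding s(2) unfolding s(1) using cardM cardF by (simp_all only: card_image inj_swap)
  show "inj_on fst (M\<inverse>)" "inj_on snd (M\<inverse>)"
    using inj_fst inj_snd unfolding s by (auto simp: inj_on_def)
  have "fst ` prod.swap ` M = snd ` M" "snd ` prod.swap ` M = fst ` M"
    by (simp_all add: image_image)
  then show "fst ` (M\<inverse>) \<inter> snd ` (M\<inverse>) = {}" unfolding s using disj by auto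
qed

lemma zagreb_sum_bound:
  assumes m: "m \<ge> 3" and asym: "\<And>u v. (u, v) \<in> A \<Longrightarrow> (v, u) \<notin> A"
    and cover: "fst ` A \<union> snd ` A \<subseteq> fst ` M \<union> snd ` M"
  defines "V \<equiv> fst ` M \<union> snd ` M"
  shows "zagreb_sum A \<le> int m ^ 2 + 9 * int m + 2 \<and>
    (zagreb_sum A = int m ^ 2 + 9 * int m + 2 \<longrightarrow> windmill V A m \<or> windmill V (A\<inverse>) m)"
proof (cases rule: star_or_disjoint_arcs[of F])
  case (1 c)
  then show ?thesis using zagreb_sum_out_star[OF m asym cover] unfolding V_def by blast
next
  case (2 c)
  \<comment> \<open>Reversal turns the in-star into an out-star and preserves the Zagreb
    sum.\<close>
  interpret C: arc_matching "A\<inverse>" "M\<inverse>" m by (rule arc_matching_converse)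
  have swap: "fst ` (R\<inverse>) = snd ` R" "snd ` (R\<inverse>) = fst ` R" for R :: "('a \<times> 'a) set" by force+
  have "C.F \<subseteq> {c} \<times> UNIV" using 2 by auto
  moreover have "(v, u) \<notin> A\<inverse>" if "(u, v) \<in> A\<inverse>" for u v using that asym by auto
  moreover have "fst ` (A\<inverse>) \<union> snd ` (A\<inverse>) \<subseteq> fst ` (M\<inverse>) \<union> snd ` (M\<inverse>)"
    unfolding swap using cover by blast
  ultimately have "zagreb_sum (A\<inverse>) \<le> int m ^ 2 + 9 * int m + 2"
    "zagreb_sum (A\<inverse>) = int m ^ 2 + 9 * int m + 2 \<Longrightarrow> windmill (fst ` (M\<inverse>) \<union> snd ` (M\<inverse>)) (A\<inverse>) m"
    using C.zagreb_sum_out_star[OF m] by blast+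
  then show ?thesis unfolding V_def zagreb_sum_converse swap by (simp add: Un_commute)
next
  case (3 a b)
  then show ?thesis using zagreb_sum_non_star[OF m] by fastforce
qed

end

text \<open>The arcs outside the matching form an out-star whose centre is a tail in
  \<open>M\<close>. Only the heads \<open>fst d\<close> and \<open>fst e\<close> are misplaced, so
  the defect is 2 and no pair is disjoint.\<close>

lemma zagreb_sum_windmill:
  assumes "windmill V A m"
  shows "zagreb_sum A = int m ^ 2 + 9 * int m + 2"
proof -
  obtain M p d e where M: "finite M" "card M = m" and inj: "inj_on fst M" "inj_on snd M"
    and disj: "fst ` M \<inter> snd ` M = {}"
    and pde: "p \<in> M" "d \<in> M" "e \<in> M" "p \<noteq> d" "p \<noteq> e" "d \<noteq> e"
    and A: "A = M \<union> {fst p} \<times> (snd ` (M - {p}) \<union> {fst d, fst e})"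
    using assms(1) unfolding windmill_def by blast
  let ?T = "snd ` (M - {p}) \<union> {fst d, fst e}"
  have "fst d \<noteq> fst e" using inj(1) pde by (auto dest: inj_onD)
  moreover have "snd ` (M - {p}) \<inter> {fst d, fst e} = {}" using disj pde by blast
  ultimately have "card ?T = card (M - {p}) + 2"
    using M inj by (subst card_Un_disjoint) (auto simp: card_image inj_on_diff)
  moreover have "m > 0" using M pde(1) card_gt_0_iff[of M] by auto
  ultimately have cardT: "card ?T = m + 1" using M pde by simp
  have "a \<notin> M" if a: "a \<in> {fst p} \<times> ?T" for a
  proof
    assume "a \<in> M"
    moreover have "fst a = fst p" using a by auto
    ultimately have "a = p" using inj_onD[OF inj(1)] pde(1) by metis
    then have "p \<in> {fst p} \<times> ?T" using a by simp
    then have "snd p \<in> ?T" by (metis SigmaE2 prod.collapse)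
    moreover have "snd p \<notin> snd ` (M - {p})" using inj_onD[OF inj(2)] pde(1) by blast
    ultimately show False using disj pde by blast
  qed
  then have F: "A - M = {fst p} \<times> ?T" unfolding A by blast
  interpret arc_matching A M m
  proof
    show "finite A" "M \<subseteq> A" using M A by auto
    show "card (A - M) = m + 1" unfolding F card_cartesian_product cardT by simp
  qed (fact inj disj M)+
  have "F \<subseteq> {fst p} \<times> UNIV" unfolding F by blast
  note defect = out_star_defect[OF this]
  have "snd ` F = ?T" unfolding F by force
  then have "snd ` F - snd ` M = {fst d, fst e}" using disj pde by blast
  then have "defect = 2" using defect(2) pde \<open>fst d \<noteq> fst e\<close> by simp
  then show ?thesis unfolding zagreb_sum_eq defect(1) by simp
qed

section \<open>Isomorphisms as injective vertex maps\<close>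

lemma digraph_iso_with_projI:
  assumes "pair_wf_digraph D" "inj_on f (pverts D)" "pverts E = f ` pverts D"
    "parcs E = map_prod f f ` parcs D"
  shows "digraph_iso (with_proj D) (with_proj E)"
proof -
  interpret pair_wf_digraph D by fact
  define h where "h = \<lparr> iso_verts = f, iso_arcs = map_prod f f, iso_head = snd, iso_tail = fst \<rparr>"
  have "inj_on (map_prod f f) (parcs D)"
    using map_prod_inj_on[OF assms(2,2)] by (rule inj_on_subset) (auto dest: wellformed')
  then have "pre_digraph.digraph_isomorphism (with_proj D) h"
    unfolding pre_digraph.digraph_isomorphism_def
    using wf_digraph_axioms assms(2) by (auto simp: h_def)
  moreover have "with_proj E = app_iso h (with_proj D)"
    using assms(3,4) by (simp add: app_iso_def h_def with_proj_def)
  ultimately show ?thesis unfolding digraph_iso_def by blast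
qed

text \<open>An isomorphism carries its own arc map, tail and head. Between \<open>with_proj\<close>
  digraphs the latter two are \<open>fst\<close> and \<open>snd\<close>, so the vertex map
  determines the arc map.\<close>

lemma digraph_iso_with_projE:
  assumes "digraph_iso (with_proj D) (with_proj E)"
  obtains f where "inj_on f (pverts D)" "parcs D \<subseteq> pverts D \<times> pverts D"
    "parcs E = map_prod f f ` parcs D"
proof -
  obtain h where h: "pre_digraph.digraph_isomorphism (with_proj D) h"
    and E: "with_proj E = app_iso h (with_proj D)"
    using assms unfolding digraph_iso_def by blast
  have *: "wf_digraph (with_proj D)" "inj_on (iso_verts h) (pverts D)"
    "\<And>a. a \<in> parcs D \<Longrightarrow> iso_verts h (fst a) = iso_tail h (iso_arcs h a)
      \<and> iso_verts h (snd a) = iso_head h (iso_arcs h a)"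
    using h unfolding pre_digraph.digraph_isomorphism_def by auto
  have "parcs E = iso_arcs h ` parcs D" "iso_tail h = fst" "iso_head h = snd"
    using arg_cong[OF E, of arcs] arg_cong[OF E, of tail] arg_cong[OF E, of head] by simp_all
  then have "parcs E = map_prod (iso_verts h) (iso_verts h) ` parcs D"
    using *(3) by (auto intro!: image_cong simp: prod_eq_iff)
  moreover have "parcs D \<subseteq> pverts D \<times> pverts D"
    using *(1) by (auto simp: wf_digraph_def)
  ultimately show thesis using that *(2) by blast
qed

lemma zagreb_sum_digraph_iso:
  assumes "digraph_iso (with_proj D) (with_proj E)"
  shows "zagreb_sum (parcs E) = zagreb_sum (parcs D)"
proof -
  obtain f where "inj_on f (pverts D)" "parcs D \<subseteq> pverts D \<times> pverts D"
    "parcs E = map_prod f f ` parcs D"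
    using assms by (rule digraph_iso_with_projE)
  then show ?thesis using zagreb_sum_map_prod by metis
qed

section \<open>The labelled digraph \<open>B1\<close>\<close>

lemma windmill_B1:
  assumes "m \<ge> 3"
  shows "windmill (pverts (B1 m)) (parcs (B1 m)) m"
proof -
  \<comment> \<open>\<open>g i\<close> is the matching arc on the labels \<open>2 * i\<close> and
    \<open>2 * i + 1\<close>: even to odd for the pendent and triangle arcs, odd to even for the
    outer path arcs. Halving an end recovers \<open>i\<close>.\<close>
  define g :: "nat \<Rightarrow> nat \<times> nat"
    where "g i = (if i < 3 then (2 * i, 2 * i + 1) else (2 * i + 1, 2 * i))" for i
  define M where "M = g ` {..<m}"
  have half: "fst (g i) div 2 = i" "snd (g i) div 2 = i" for i by (auto simp: g_def)
  have ne: "fst (g i) \<noteq> snd (g i)" for i by (auto simp: g_def)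
  have injg: "inj_on g S" for S by (metis half(1) inj_onI)
  have 1: "inj_on fst M"
  proof (rule inj_onI)
    fix a b assume "a \<in> M" "b \<in> M" and eq: "fst a = fst b"
    then obtain i j where ij: "a = g i" "b = g j" by (auto simp: M_def)
    then have "i = j" using eq half(1) by metis
    then show "a = b" using ij by simp
  qed
  have 2: "inj_on snd M"
  proof (rule inj_onI)
    fix a b assume "a \<in> M" "b \<in> M" and eq: "snd a = snd b"
    then obtain i j where ij: "a = g i" "b = g j" by (auto simp: M_def)
    then have "i = j" using eq half(2) by metis
    then show "a = b" using ij by simp
  qed
  have 3: "fst ` M \<inter> snd ` M = {}"
  proof -
    have False if "fst (g i) = snd (g j)" for i j
    proof -
      have "i = j" using that half by metis
      then show False using that ne by simp
    qed
    then show ?thesis unfolding M_def by blast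
  qed
  have 4: "pverts (B1 m) = fst ` M \<union> snd ` M"
  proof -
    have "{fst (g i), snd (g i)} = {2 * i, 2 * i + 1}" for i by (auto simp: g_def)
    then have "fst ` M \<union> snd ` M = (\<Union>i<m. {2 * i, 2 * i + 1})" unfolding M_def by blast
    also have "\<dots> = {0..<2 * m}"
    proof
      show "{0..<2 * m} \<subseteq> (\<Union>i<m. {2 * i, 2 * i + 1})"
      proof
        fix x :: nat assume "x \<in> {0..<2 * m}"
        then have "x div 2 < m" "x \<in> {2 * (x div 2), 2 * (x div 2) + 1}" by auto
        then show "x \<in> (\<Union>i<m. {2 * i, 2 * i + 1})" by blast
      qed
    qed auto
    finally show ?thesis by (simp add: B1_def)
  qed
  have 5: "g 0 \<in> M" "g 1 \<in> M" "g 2 \<in> M" using assms by (auto simp: M_def)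
  have 6: "g 0 \<noteq> g 1" "g 0 \<noteq> g 2" "g 1 \<noteq> g 2" by (auto simp: g_def)
  have 7: "parcs (B1 m) = M \<union> {fst (g 0)} \<times> (snd ` (M - {g 0}) \<union> {fst (g 1), fst (g 2)})"
  proof -
    have i: "{..<m} = {0, 1, 2} \<union> {3..<m}" using assms by auto
    have M: "M = {(0, 1), (2, 3), (4, 5)} \<union> (\<lambda>i. (2 * i + 1, 2 * i)) ` {3..<m}"
      unfolding M_def i image_Un by (auto simp: g_def)
    have "M - {g 0} = {(2, 3), (4, 5)} \<union> (\<lambda>i. (2 * i + 1, 2 * i)) ` {3..<m}"
      unfolding M by (auto simp: g_def)
    then have "snd ` (M - {g 0}) = {3, 5} \<union> (\<lambda>i. 2 * i) ` {3..<m}"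
      by (simp add: image_Un image_image)
    moreover have "fst (g 0) = 0" "fst (g 1) = 2" "fst (g 2) = 4" by (simp_all add: g_def)
    moreover have "(\<Union>i\<in>{3..<m}. {(0, 2 * i), (2 * i + 1, 2 * i)})
        = {0} \<times> (\<lambda>i. 2 * i) ` {3..<m} \<union> (\<lambda>i. (2 * i + 1, 2 * i)) ` {3..<m}" by blast
    ultimately show ?thesis unfolding M B1_def by (simp only: pair_pre_digraph.simps) blast
  qed
  have 8: "finite M" "card M = m" using injg by (simp_all add: M_def card_image)
  show ?thesis
    unfolding windmill_def
    by (intro exI[of _ M] exI[of _ "g 0"] exI[of _ "g 1"] exI[of _ "g 2"] conjI)
      (fact 1 2 3 4 5 6 7 8)+
qed

section \<open>Orientations of bicyclic graphs and the theorem\<close>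

lemma orientation_arc_matching:
  fixes G D :: "'a pair_pre_digraph"
  assumes G: "pair_graph G" "card (pverts G) = 2 * m" "card (uedges G) = 2 * m + 1"
    and mn: "matching_number G = m" and D: "orientation_of D G"
  obtains M where "arc_matching (parcs D) M m" "pverts D = fst ` M \<union> snd ` M"
proof -
  interpret pair_graph G by fact
  let ?A = "parcs D" and ?e = "\<lambda>(u, v). {u, v}"
  have V: "pverts D = pverts G" and A: "?A \<subseteq> parcs G"
    and orient: "\<And>u v. (u, v) \<in> parcs G \<Longrightarrow> ((u, v) \<in> ?A) \<noteq> ((v, u) \<in> ?A)"
    using D by (auto simp: orientation_of_def)
  have finA: "finite ?A" using A pair_finite_arcs finite_subset by blast
  have sym: "(v, u) \<in> parcs G" if "(u, v) \<in> parcs G" for u v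
    using that pair_sym_arcs by (auto simp: symmetric_def dest: symD)
  have e_inj: "inj_on ?e ?A"
  proof (rule inj_onI)
    fix a b assume "a \<in> ?A" "b \<in> ?A" "?e a = ?e b"
    then show "a = b" using orient A by (cases a; cases b) (auto simp: doubleton_eq_iff)
  qed
  have e_im: "?e ` ?A = uedges G"
  proof
    show "uedges G \<subseteq> ?e ` ?A"
    proof
      fix x assume "x \<in> uedges G"
      then obtain u v where uv: "(u, v) \<in> parcs G" "x = {u, v}" by (auto simp: uedges_def)
      then consider "(u, v) \<in> ?A" | "(v, u) \<in> ?A" using orient by blast
      then show "x \<in> ?e ` ?A" using uv(2) by cases (auto intro!: rev_image_eqI)
    qed
  qed (use A in \<open>auto simp: uedges_def\<close>)
  have cardA: "card ?A = 2 * m + 1" using card_image[OF e_inj] e_im G(3) by simp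
  have finU: "finite (uedges G)" using finA e_im by (metis finite_imageI)
  \<comment> \<open>There are finitely many matchings and at least the empty one, so the maximum is
    attained.\<close>
  have "finite {N. matching G N}"
    by (rule finite_subset[of _ "Pow (uedges G)"]) (use finU in \<open>auto simp: matching_def\<close>)
  moreover have "matching G {}" by (simp add: matching_def)
  ultimately have "matching_number G \<in> card ` {N. matching G N}"
    unfolding matching_number_def by (intro Max_in) auto
  then obtain N where N: "N \<subseteq> uedges G" "pairwise disjnt N" "card N = m"
    using mn by (auto simp: matching_def)
  \<comment> \<open>Each edge carries exactly one arc of \<open>D\<close>, so \<open>N\<close> pulls
    back to \<open>m\<close> arcs.\<close>
  define M where "M = {a \<in> ?A. ?e a \<in> N}"
  have MA: "M \<subseteq> ?A" by (auto simp: M_def)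
  have "?e ` M = N" using N(1) unfolding e_im[symmetric] M_def by blast
  then have cardM: "card M = m"
    using N(3) card_image[OF inj_on_subset[OF e_inj MA]] by simp
  have finM: "finite M" using MA finA finite_subset by blast
  have loop: "fst a \<noteq> snd a" if "a \<in> ?A" for a using that A pair_no_loops by blast
  have apart: "{fst a, snd a} \<inter> {fst b, snd b} = {}" if "a \<in> M" "b \<in> M" "a \<noteq> b" for a b
  proof -
    have "?e a \<in> N" "?e b \<in> N" "?e a \<noteq> ?e b"
      using that e_inj MA by (auto simp: M_def dest: inj_onD)
    then have "disjnt (?e a) (?e b)" using N(2) by (meson pairwiseD)
    then show ?thesis by (cases a; cases b) (simp add: disjnt_def)
  qed
  have inj: "inj_on fst M" "inj_on snd M"
    using apart by (auto intro!: inj_onI)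
  have disj: "fst ` M \<inter> snd ` M = {}"
  proof -
    have "fst a \<noteq> snd b" if "a \<in> M" "b \<in> M" for a b
      using apart[OF that] loop[of a] that MA by (cases "a = b") auto
    then show ?thesis by blast
  qed
  have "card (?A - M) = m + 1"
    using cardA cardM MA finM by (simp add: card_Diff_subset)
  then have "arc_matching ?A M m"
    using finA MA inj disj cardM by unfold_locales auto
  \<comment> \<open>The \<open>2 * m\<close> distinct ends exhaust the vertices, so the matching is
    perfect.\<close>
  moreover have "fst ` M \<union> snd ` M = pverts G"
  proof (rule card_subset_eq)
    show "finite (pverts G)" by (rule pair_finite_verts)
    show "fst ` M \<union> snd ` M \<subseteq> pverts G"
      using MA A arc_fst_in_verts arc_snd_in_verts by blast
    show "card (fst ` M \<union> snd ` M) = card (pverts G)"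
      unfolding G(2) using finM disj inj cardM
      by (subst card_Un_disjoint) (simp_all add: card_image)
  qed
  ultimately show thesis using that V by simp
qed

theorem theorem1:
  fixes m :: nat and G D :: "'a pair_pre_digraph"
  assumes "m \<ge> 3"
    and "bicyclic G"
    and "card (pverts G) = 2 * m"
    and "matching_number G = m"
    and "orientation_of D G"
  shows "first_zagreb D \<le> 1 / 2 * (real m ^ 2 + 9 * real m + 2) \<and>
    (first_zagreb D = 1 / 2 * (real m ^ 2 + 9 * real m + 2) \<longleftrightarrow>
      digraph_iso (with_proj D) (with_proj (B1 m)) \<or>
      digraph_iso (with_proj D) (with_proj (B2 m)))"
proof -
  let ?A = "parcs D" and ?b = "int m ^ 2 + 9 * int m + 2"
  have G: "pair_graph G" "card (uedges G) = 2 * m + 1"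
    using assms(2,3) by (auto simp: bicyclic_def)
  interpret G: pair_graph G by (rule G)
  obtain M where M: "arc_matching ?A M m" and V: "pverts D = fst ` M \<union> snd ` M"
    using orientation_arc_matching[OF G(1) assms(3) G(2) assms(4,5)] .
  interpret arc_matching ?A M m by (rule M)
  have D: "pverts D = pverts G" "?A \<subseteq> parcs G"
    "\<And>u v. (u, v) \<in> parcs G \<Longrightarrow> ((u, v) \<in> ?A) \<noteq> ((v, u) \<in> ?A)"
    using assms(5) by (auto simp: orientation_of_def)
  have wf: "pair_wf_digraph D"
    by unfold_locales
      (auto dest!: subsetD[OF D(2)] dest: G.in_arcsD1 G.in_arcsD2 simp: D(1))
  have asym: "(v, u) \<notin> ?A" if "(u, v) \<in> ?A" for u v using that D(2,3) by blast
  have cover: "fst ` ?A \<union> snd ` ?A \<subseteq> fst ` M \<union> snd ` M"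
    unfolding V[symmetric] using wf by (auto simp: pair_wf_digraph_def)
  have bound: "zagreb_sum ?A \<le> ?b"
    and eqD: "zagreb_sum ?A = ?b \<Longrightarrow> windmill (pverts D) ?A m \<or> windmill (pverts D) (?A\<inverse>) m"
    using zagreb_sum_bound[OF assms(1) asym cover] V by auto
  have B1: "windmill (pverts (B1 m)) (parcs (B1 m)) m" by (rule windmill_B1[OF assms(1)])
  have eq_iff: "zagreb_sum ?A = ?b \<longleftrightarrow>
    digraph_iso (with_proj D) (with_proj (B1 m)) \<or> digraph_iso (with_proj D) (with_proj (B2 m))"
  proof
    assume "zagreb_sum ?A = ?b"
    from eqD[OF this] show "digraph_iso (with_proj D) (with_proj (B1 m)) \<or>
      digraph_iso (with_proj D) (with_proj (B2 m))"
    proof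
      assume "windmill (pverts D) ?A m"
      then obtain f where "inj_on f (pverts D)" "pverts (B1 m) = f ` pverts D"
        "parcs (B1 m) = map_prod f f ` ?A" using B1 by (rule windmill_iso)
      then show ?thesis using digraph_iso_with_projI[OF wf] by blast
    next
      assume "windmill (pverts D) (?A\<inverse>) m"
      then obtain f where f: "inj_on f (pverts D)" "pverts (B1 m) = f ` pverts D"
        and B: "parcs (B1 m) = map_prod f f ` (?A\<inverse>)" using B1 by (rule windmill_iso)
      \<comment> \<open>If reversed \<open>D\<close> maps onto \<open>B1\<close>, the same vertex
        map sends \<open>D\<close> itself onto \<open>B2\<close>.\<close>
      have "parcs (B2 m) = map_prod f f ` ?A" unfolding B2_def B by force
      moreover have "pverts (B2 m) = pverts (B1 m)" by (simp add: B2_def)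
      ultimately show ?thesis using digraph_iso_with_projI[OF wf f(1)] f(2) by simp
    qed
  next
    have "zagreb_sum (parcs (B1 m)) = ?b" by (rule zagreb_sum_windmill[OF B1])
    moreover have "zagreb_sum (parcs (B2 m)) = zagreb_sum (parcs (B1 m))"
      by (simp add: B2_def zagreb_sum_converse)
    moreover assume "digraph_iso (with_proj D) (with_proj (B1 m)) \<or>
      digraph_iso (with_proj D) (with_proj (B2 m))"
    ultimately show "zagreb_sum ?A = ?b" using zagreb_sum_digraph_iso by metis
  qed
  have b: "real m ^ 2 + 9 * real m + 2 = real_of_int ?b" by simp
  have z: "first_zagreb D = 1 / 2 * real_of_int (zagreb_sum ?A)"
    by (rule first_zagreb_eq_zagreb_sum[OF fin])
  have "first_zagreb D \<le> 1 / 2 * (real m ^ 2 + 9 * real m + 2)"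
    unfolding z b using bound
    by (intro mult_left_mono of_int_le_iff[THEN iffD2]) simp_all
  moreover have "first_zagreb D = 1 / 2 * (real m ^ 2 + 9 * real m + 2) \<longleftrightarrow> zagreb_sum ?A = ?b"
    unfolding z b by (simp only: mult_cancel_left of_int_eq_iff) simp
  ultimately show ?thesis using eq_iff by blast
qed

end
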